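(* Let $\rho>0$ and let $T_0,T_1\in C_\rho(H)$. If $T_1$ and $T_0$ are Harnack equivalent in $C_\rho(H)$, then $\Gamma(T_1)=\Gamma(T_0)$.
   Context: $H$ is a complex Hilbert space and $B(H)$ is the algebra of bounded linear operators on $H$; $\mathbb{D}$ is the open unit disc and $\mathbb{T}$ the unit circle. For $\rho>0$, $C_\rho(H)$ is the set of all $T\in B(H)$ admitting a unitary $\rho$-dilation: there are a Hilbert space $\mathcal{H}$ containing $H$ as a closed subspace and a unitary $U\in B(\mathcal{H})$ with $T^n=\rho P_H U^n|_H$ for all integers $n\ge 1$, where $P_H$ is the orthogonal projection of $\mathcal H$ onto $H$. Every $T\in C_\rho(H)$ has $\sigma(T)\subseteq\overline{\mathbb{D}}$, and its $\rho$-kernel is $K_z^\rho(T)=(I-\overline{z}T)^{-1}+(I-zT^* )^{-1}+(\rho-2)I$ for $z\in\mathbb{D}$. For $T_0,T_1\in C_\rho(H)$, $T_1$ is Harnack dominated by $T_0$ if there is a constant $c\ge 1$ with $K_z^\rho(T_1)\le c^2K_z^\rho(T_0)$ for all $z\in\mathbb{D}$; $T_0$ and $T_1$ are Harnack equivalent if each is Harnack dominated by the other. Finally, $\Gamma(T)=\sigma(T)\cap\mathbb{T}$. *)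

theory Defs
  imports "HOL-Analysis.Analysis"
begin

text \<open>
  Complex Hilbert spaces, built on top of the underlying real Hilbert space.  The inner product
  is linear in the first argument; positive definiteness and the usual formula for the norm are
  inherited from \<^class>\<open>real_inner\<close> through \<open>inner_eq_Re_cinner\<close>.
\<close>

class chilbert_space = real_inner + complete_space +
  fixes scaleC :: "complex \<Rightarrow> 'a \<Rightarrow> 'a"  (infixr "*\<^sub>C" 75)
    and cinner :: "'a \<Rightarrow> 'a \<Rightarrow> complex"
  assumes scaleC_add_right: "a *\<^sub>C (x + y) = a *\<^sub>C x + a *\<^sub>C y"
    and scaleC_add_left: "(a + b) *\<^sub>C x = a *\<^sub>C x + b *\<^sub>C x"
    and scaleC_scaleC: "a *\<^sub>C (b *\<^sub>C x) = (a * b) *\<^sub>C x"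
    and scaleC_one: "1 *\<^sub>C x = x"
    and scaleR_eq_scaleC: "r *\<^sub>R x = complex_of_real r *\<^sub>C x"
    and cinner_commute: "cinner x y = cnj (cinner y x)"
    and cinner_add_left: "cinner (x + y) z = cinner x z + cinner y z"
    and cinner_scaleC_left: "cinner (a *\<^sub>C x) y = a * cinner x y"
    and inner_eq_Re_cinner: "inner x y = Re (cinner x y)"
begin

subclass banach ..

end

instantiation complex :: chilbert_space
begin

definition scaleC_complex :: "complex \<Rightarrow> complex \<Rightarrow> complex"
  where "scaleC_complex a x = a * x"

definition cinner_complex :: "complex \<Rightarrow> complex \<Rightarrow> complex"
  where "cinner_complex x y = x * cnj y"

instance
  by standard
    (auto simp: scaleC_complex_def cinner_complex_def algebra_simps inner_complex_def
      scaleR_conv_of_real)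

end

text \<open>Operators are plain functions; membership in \<open>B(H)\<close> is the following predicate.\<close>

definition bounded_clinear :: "('a::chilbert_space \<Rightarrow> 'b::chilbert_space) \<Rightarrow> bool"
  where "bounded_clinear T \<longleftrightarrow> bounded_linear T \<and> (\<forall>a x. T (a *\<^sub>C x) = a *\<^sub>C T x)"

text \<open>For bounded \<open>T\<close> the adjoint exists (Riesz) and is unique.\<close>

definition cadjoint :: "('a::chilbert_space \<Rightarrow> 'a) \<Rightarrow> 'a \<Rightarrow> 'a"
  where "cadjoint T = (THE S. \<forall>x y. cinner (T x) y = cinner x (S y))"

definition unitary_op :: "('a::chilbert_space \<Rightarrow> 'a) \<Rightarrow> bool"
  where "unitary_op U \<longleftrightarrow>
    bounded_clinear U \<and> cadjoint U \<circ> U = id \<and> U \<circ> cadjoint U = id"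

text \<open>The orthogonal projection onto \<open>M\<close>; meaningful when \<open>M\<close> is a closed subspace.\<close>

definition orth_proj :: "'a::chilbert_space set \<Rightarrow> 'a \<Rightarrow> 'a"
  where "orth_proj M x = (THE y. y \<in> M \<and> (\<forall>m\<in>M. cinner (x - y) m = 0))"

definition op_spectrum :: "('a::chilbert_space \<Rightarrow> 'a) \<Rightarrow> complex set"
  where "op_spectrum T = {l. \<not> (\<exists>S. bounded_clinear S \<and>
    S \<circ> (\<lambda>x. T x - l *\<^sub>C x) = id \<and> (\<lambda>x. T x - l *\<^sub>C x) \<circ> S = id)}"

definition op_le :: "('a::chilbert_space \<Rightarrow> 'a) \<Rightarrow> ('a \<Rightarrow> 'a) \<Rightarrow> bool"
  where "op_le A B \<longleftrightarrow> (\<forall>x. cinner (B x - A x) x \<in> \<real>\<^sub>\<ge>\<^sub>0)"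

text \<open>
  The inclusion of \<open>H\<close> as a closed subspace of the dilation space is an isometric embedding
  \<open>V\<close>: its range is automatically closed because \<open>H\<close> is complete.
\<close>

definition is_unitary_rho_dilation ::
  "real \<Rightarrow> ('h::chilbert_space \<Rightarrow> 'h) \<Rightarrow> ('h \<Rightarrow> 'k::chilbert_space) \<Rightarrow> ('k \<Rightarrow> 'k) \<Rightarrow> bool"
  where "is_unitary_rho_dilation \<rho> T V U \<longleftrightarrow>
    bounded_clinear V \<and> (\<forall>x y. cinner (V x) (V y) = cinner x y) \<and> unitary_op U \<and>
    (\<forall>n\<ge>1. \<forall>x. V ((T ^^ n) x) = \<rho> *\<^sub>R orth_proj (range V) ((U ^^ n) (V x)))"

text \<open>
  HOL cannot quantify existentially over the type of the dilation space, so this type is a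
  parameter: \<open>T\<close> is in \<open>C\<^sub>\<rho>(H)\<close> iff it is in \<open>rho_class TYPE('k) \<rho>\<close> for some \<open>'k\<close>.
  A theorem assuming \<open>T \<in> rho_class TYPE('k) \<rho>\<close> with \<open>'k\<close> a type variable that occurs nowhere
  else is therefore a theorem about all of \<open>C\<^sub>\<rho>(H)\<close>; two operators need two such variables.
\<close>

definition rho_class ::
  "'k::chilbert_space itself \<Rightarrow> real \<Rightarrow> ('h::chilbert_space \<Rightarrow> 'h) set"
  where "rho_class (_ :: 'k itself) \<rho> =
    {T. bounded_clinear T \<and> (\<exists>(V :: 'h \<Rightarrow> 'k) U. is_unitary_rho_dilation \<rho> T V U)}"

text \<open>
  For \<open>T\<close> in \<open>C\<^sub>\<rho>(H)\<close> and \<open>\<bar>z\<bar> < 1\<close> both operators inverted below are bijective, since the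
  spectrum of \<open>T\<close> lies in the closed unit disc.
\<close>

definition rho_kernel ::
  "real \<Rightarrow> complex \<Rightarrow> ('h::chilbert_space \<Rightarrow> 'h) \<Rightarrow> 'h \<Rightarrow> 'h"
  where "rho_kernel \<rho> z T = (\<lambda>x.
    inv (\<lambda>y. y - cnj z *\<^sub>C T y) x + inv (\<lambda>y. y - z *\<^sub>C cadjoint T y) x + (\<rho> - 2) *\<^sub>R x)"

text \<open>\<open>harnack_dominated \<rho> T1 T0\<close>: \<open>T1\<close> is dominated by \<open>T0\<close>.\<close>

definition harnack_dominated ::
  "real \<Rightarrow> ('h::chilbert_space \<Rightarrow> 'h) \<Rightarrow> ('h \<Rightarrow> 'h) \<Rightarrow> bool"
  where "harnack_dominated \<rho> T1 T0 \<longleftrightarrow>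
    (\<exists>c\<ge>1::real. \<forall>z\<in>ball 0 1.
      op_le (rho_kernel \<rho> z T1) (\<lambda>x. c\<^sup>2 *\<^sub>R rho_kernel \<rho> z T0 x))"

definition harnack_equivalent ::
  "real \<Rightarrow> ('h::chilbert_space \<Rightarrow> 'h) \<Rightarrow> ('h \<Rightarrow> 'h) \<Rightarrow> bool"
  where "harnack_equivalent \<rho> T1 T0 \<longleftrightarrow>
    harnack_dominated \<rho> T1 T0 \<and> harnack_dominated \<rho> T0 T1"

definition peripheral_spectrum :: "('h::chilbert_space \<Rightarrow> 'h) \<Rightarrow> complex set"
  where "peripheral_spectrum T = op_spectrum T \<inter> sphere 0 1"

end

theory Submission
  imports Defs
begin

text \<open>
  A dilation makes \<open>T\<close> power bounded, so \<open>R\<^sub>r(T) = (I - r \<lambda>\<^sup>* T)\<^sup>-\<^sup>1\<close> exists for \<open>\<bar>\<lambda>\<bar> = 1\<close> and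
  \<open>r < 1\<close>, where \<open>\<lambda>\<^sup>*\<close> is the conjugate of \<open>\<lambda>\<close>, and the kernel at \<open>z = r \<lambda>\<close> has the quadratic
  form \<open>2 Re \<langle>R\<^sub>r(T) x, x\<rangle> + (\<rho> - 2) \<parallel>x\<parallel>\<^sup>2\<close>.  If \<open>\<lambda>\<close> is outside the spectrum of \<open>T\<^sub>0\<close>, then
  \<open>R\<^sub>r(T\<^sub>0)\<close> stays bounded as \<open>r \<rightarrow> 1\<close>.  If \<open>\<lambda>\<close> is in the spectrum of \<open>T\<^sub>1\<close>, it is a boundary
  point of that spectrum, hence an approximate eigenvalue, and at approximate unit eigenvectors
  the form of \<open>T\<^sub>1\<close> is at least of order \<open>1 / (1 - r)\<close>.  So Harnack domination of \<open>T\<^sub>1\<close> by \<open>T\<^sub>0\<close>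
  forces \<open>\<Gamma>(T\<^sub>1) \<subseteq> \<Gamma>(T\<^sub>0)\<close>.
\<close>

section \<open>Adjoints and projections\<close>

text \<open>If \<open>f\<close> is the inner product with \<open>z\<close>, then
  \<open>(norm x)\<^sup>2 - 2 * f x\<close> differs from the squared distance of \<open>x\<close> to
  \<open>z\<close> by a constant. So \<open>z\<close> is sought as a minimiser of this functional
  \<open>g\<close>, and the first-order condition at the minimiser is the representation.\<close>

lemma riesz_representation:
  fixes f :: "'a::{real_inner,complete_space} \<Rightarrow> real"
  assumes "bounded_linear f"
  obtains z where "\<And>x. f x = inner x z"
proof -
  interpret f: bounded_linear f by fact
  define g where "g x = (norm x)\<^sup>2 - 2 * f x" for x
  obtain K where K: "\<And>x. norm (f x) \<le> norm x * K" using f.bounded by blast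
  have lower: "g x \<ge> - K\<^sup>2" for x
  proof -
    have "f x \<le> norm x * K" using K[of x] by simp
    moreover have "(norm x - K)\<^sup>2 \<ge> 0" by simp
    ultimately show ?thesis by (simp add: g_def power2_eq_square algebra_simps)
  qed
  have bdd: "bdd_below (range g)" using lower by (intro bdd_belowI2)
  define d where "d = Inf (range g)"
  have d_le: "d \<le> g x" for x unfolding d_def by (intro cInf_lower bdd) auto
  have "\<exists>x. g x < d + 1 / real (Suc n)" for n
    using cInf_lessD[of "range g" "d + 1 / real (Suc n)"] by (auto simp: d_def)
  then obtain X where X: "\<And>n. g (X n) < d + 1 / real (Suc n)" by metis
  \<comment> \<open>Parallelogram law: the linear part of \<open>g\<close> cancels. As
    \<open>g\<close> is at least \<open>d\<close> at the midpoint, two almost minimisers are close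
    to each other.\<close>
  have par: "(norm (x - y))\<^sup>2 = 2 * g x + 2 * g y - 4 * g ((1/2) *\<^sub>R (x + y))" for x y
  proof -
    have "(norm (x - y))\<^sup>2 = 2 * (norm x)\<^sup>2 + 2 * (norm y)\<^sup>2 - (norm (x + y))\<^sup>2"
      by (simp add: power2_norm_eq_inner inner_add inner_diff inner_commute[of y x])
    then show ?thesis by (simp add: g_def f.scaleR f.add power_divide add_divide_distrib)
  qed
  have X_dist: "(norm (X m - X n))\<^sup>2 \<le> 4 / real (Suc N)" if "m \<ge> N" "n \<ge> N" for m n N
  proof -
    have "1 / real (Suc k) \<le> 1 / real (Suc N)" if "k \<ge> N" for k
      using that by (simp add: frac_le)
    from this[OF that(1)] this[OF that(2)]
    have "2 * g (X m) + 2 * g (X n) - 4 * g ((1/2) *\<^sub>R (X m + X n)) \<le> 4 * (1 / real (Suc N))"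
      using X[of m] X[of n] d_le[of "(1/2) *\<^sub>R (X m + X n)"] by linarith
    then show ?thesis by (simp add: par)
  qed
  have "Cauchy X"
  proof (rule metric_CauchyI)
    fix e :: real assume "e > 0"
    then obtain N where N: "1 / real (Suc N) < e\<^sup>2 / 4"
      using nat_approx_posE[of "e\<^sup>2 / 4"] by auto
    have "dist (X m) (X n) < e" if "m \<ge> N" "n \<ge> N" for m n
    proof -
      have "(norm (X m - X n))\<^sup>2 < e\<^sup>2" using X_dist[OF that] N by simp
      then show ?thesis using \<open>e > 0\<close> by (simp add: dist_norm power_less_imp_less_base)
    qed
    then show "\<exists>N. \<forall>m\<ge>N. \<forall>n\<ge>N. dist (X m) (X n) < e" by blast
  qed
  then obtain z where z: "X \<longlonglongrightarrow> z" using Cauchy_convergent convergent_def by blast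
  have lim: "(\<lambda>n. g (X n)) \<longlonglongrightarrow> g z"
    unfolding g_def by (intro tendsto_intros z f.tendsto)
  have "(\<lambda>n. d + 1 / real (Suc n)) \<longlonglongrightarrow> d + 0"
    by (intro tendsto_intros) (use LIMSEQ_inverse_real_of_nat in \<open>simp add: inverse_eq_divide\<close>)
  from LIMSEQ_le[OF lim this] have "g z \<le> d" using X by (auto intro: less_imp_le)
  then have min: "g z \<le> g x" for x using d_le[of x] by linarith
  have "f x = inner x z" for x
  proof (rule ccontr)
    assume neq: "f x \<noteq> inner x z"
    define a where "a = inner x z - f x"
    have quad: "0 \<le> t\<^sup>2 * (norm x)\<^sup>2 + 2 * t * a" for t
    proof -
      have "(norm (z + t *\<^sub>R x))\<^sup>2 = (norm z)\<^sup>2 + 2 * t * inner x z + t\<^sup>2 * (norm x)\<^sup>2"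
        by (simp only: power2_norm_eq_inner)
          (simp add: inner_add inner_commute[of z x] power2_eq_square algebra_simps)
      then show ?thesis
        using min[of "z + t *\<^sub>R x"] by (simp add: g_def a_def f.add f.scaleR algebra_simps)
    qed
    have "a \<noteq> 0" using neq by (simp add: a_def)
    \<comment> \<open>The step \<open>t = - s * a\<close> makes the linear term of
      \<open>quad\<close> outweigh the quadratic one; the summand 1 covers
      \<open>x = 0\<close>.\<close>
    define s where "s = 1 / ((norm x)\<^sup>2 + 1)"
    have s: "s > 0" "s * (norm x)\<^sup>2 \<le> 1"
      by (auto simp: s_def add_nonneg_pos divide_simps)
    have "0 \<le> (- s * a)\<^sup>2 * (norm x)\<^sup>2 + 2 * (- s * a) * a" by (rule quad)
    also have "\<dots> = (s * a\<^sup>2) * (s * (norm x)\<^sup>2 - 2)" by (simp add: power2_eq_square algebra_simps)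
    also have "\<dots> < 0" using s \<open>a \<noteq> 0\<close> by (intro mult_pos_neg) auto
    finally show False by simp
  qed
  then show ?thesis using that by blast
qed

section \<open>Identities for the complex inner product and its norm\<close>

lemma cinner_scaleC_right: "cinner x (a *\<^sub>C y) = cnj a * cinner x y"
  by (metis cinner_commute cinner_scaleC_left complex_cnj_cnj complex_cnj_mult)

lemma scaleC_minus1: "(-1) *\<^sub>C x = - (x::'a::chilbert_space)"
  using scaleR_eq_scaleC[of "-1" x] by simp

lemma cinner_minus_left: "cinner (- x) y = - cinner x (y::'a::chilbert_space)"
  by (metis cinner_scaleC_left mult_minus1 scaleC_minus1)

lemma cinner_diff_left: "cinner (x - y) z = cinner x z - cinner y (z::'a::chilbert_space)"
  using cinner_add_left[of x "- y" z] by (simp add: cinner_minus_left)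

lemma cinner_diff_right: "cinner x (y - z) = cinner x y - cinner x (z::'a::chilbert_space)"
  by (metis cinner_commute cinner_diff_left complex_cnj_diff)

lemma cinner_self: "cinner x x = complex_of_real ((norm (x::'a::chilbert_space))\<^sup>2)"
proof (rule complex_eqI)
  show "Re (cinner x x) = Re (complex_of_real ((norm x)\<^sup>2))"
    by (simp add: power2_norm_eq_inner flip: inner_eq_Re_cinner)
  have "Im (cinner x x) = - Im (cinner x x)" by (metis cinner_commute cnj.sel(2))
  then show "Im (cinner x x) = Im (complex_of_real ((norm x)\<^sup>2))" by simp
qed

lemma norm_scaleC: "norm (a *\<^sub>C x) = cmod a * norm (x::'a::chilbert_space)"
proof -
  have "complex_of_real ((norm (a *\<^sub>C x))\<^sup>2) = complex_of_real ((cmod a * norm x)\<^sup>2)"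
    by (metis cinner_self cinner_scaleC_left cinner_scaleC_right complex_norm_square
        mult.assoc of_real_mult power_mult_distrib)
  then have "(norm (a *\<^sub>C x))\<^sup>2 = (cmod a * norm x)\<^sup>2" using of_real_eq_iff by blast
  then show ?thesis by (simp add: power2_eq_iff_nonneg)
qed

lemma scaleC_diff_right: "a *\<^sub>C (x - y) = a *\<^sub>C x - a *\<^sub>C (y::'a::chilbert_space)"
  by (metis add_diff_cancel_right' diff_add_cancel scaleC_add_right)

text \<open>The real part of the product with \<open>\<i> *\<^sub>C x\<close> is minus the imaginary
  part of the product with \<open>x\<close>. This lifts results on the real inner product to the
  complex one.\<close>

lemma cinner_eqI_inner:
  fixes x y :: "'a::chilbert_space" and u v :: "'b::chilbert_space"
  assumes "\<And>a. inner (a *\<^sub>C x) y = inner (a *\<^sub>C u) v"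
  shows "cinner x y = cinner u v"
proof (rule complex_eqI)
  show "Re (cinner x y) = Re (cinner u v)"
    using assms[of 1] by (simp add: inner_eq_Re_cinner scaleC_one)
  show "Im (cinner x y) = Im (cinner u v)"
    using assms[of "\<i>"] by (simp add: inner_eq_Re_cinner cinner_scaleC_left)
qed

lemma cinner_ext:
  fixes u v :: "'a::chilbert_space"
  assumes "\<And>x. cinner x u = cinner x v"
  shows "u = v"
proof -
  have "cinner (u - v) (u - v) = 0" using assms by (simp add: cinner_diff_right)
  then show ?thesis by (simp add: cinner_self)
qed

text \<open>Real Riesz representation of \<open>\<lambda>x. inner (T x) y\<close> yields
  \<open>S y\<close>, and complex linearity of \<open>T\<close> upgrades the identity to
  \<open>cinner\<close>. Two types are allowed because the embedding into the dilation space also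
  needs an adjoint.\<close>

lemma adjoint_exists:
  fixes T :: "'a::chilbert_space \<Rightarrow> 'b::chilbert_space"
  assumes "bounded_clinear T"
  obtains S where "\<And>x y. cinner (T x) y = cinner x (S y)"
proof -
  have bl: "bounded_linear T" and sc: "\<And>a x. T (a *\<^sub>C x) = a *\<^sub>C T x"
    using assms by (auto simp: bounded_clinear_def)
  have "\<exists>z. \<forall>x. inner (T x) y = inner x z" for y
  proof -
    have "bounded_linear (\<lambda>x. inner (T x) y)"
      by (intro bounded_linear_compose[OF bounded_linear_inner_left bl])
    then show ?thesis by (rule riesz_representation) blast
  qed
  then obtain S where S: "\<And>x y. inner (T x) y = inner x (S y)" by metis
  have "cinner (T x) y = cinner x (S y)" for x y
    by (rule cinner_eqI_inner) (simp add: S flip: sc)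
  then show ?thesis using that by blast
qed

lemma cadjoint_eqI:
  assumes "\<And>x y. cinner (T x) y = cinner x (S y)"
  shows "cadjoint T = S"
  unfolding cadjoint_def
proof (rule the_equality)
  fix S' assume "\<forall>x y. cinner (T x) y = cinner x (S' y)"
  then show "S' = S" using assms by - (rule ext, rule cinner_ext, metis)
qed (use assms in blast)

lemma cinner_cadjoint:
  assumes "bounded_clinear T"
  shows "cinner (T x) y = cinner x (cadjoint T y)"
  using adjoint_exists[OF assms] cadjoint_eqI by metis

lemma norm_unitary_op:
  assumes "unitary_op U"
  shows "norm (U x) = norm x"
proof -
  have U: "bounded_clinear U" "cadjoint U (U x) = x"
    using assms by (auto simp: unitary_op_def fun_eq_iff)
  have "cinner (U x) (U x) = cinner x x" by (metis U cinner_cadjoint)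
  then have "(norm (U x))\<^sup>2 = (norm x)\<^sup>2" unfolding cinner_self using of_real_eq_iff by blast
  then show ?thesis by (simp add: power2_eq_iff_nonneg)
qed

text \<open>With \<open>S\<close> the adjoint of the isometry \<open>V\<close>, the operator
  \<open>V \<circ> S\<close> is the projection, so the definite description in
  \<open>orth_proj\<close> denotes. Contractivity is Cauchy-Schwarz.\<close>

lemma norm_orth_proj_range_le:
  fixes V :: "'a::chilbert_space \<Rightarrow> 'b::chilbert_space"
  assumes V: "bounded_clinear V" and iso: "\<And>x y. cinner (V x) (V y) = cinner x y"
  shows "norm (orth_proj (range V) y) \<le> norm y"
proof -
  obtain S where S: "\<And>x y. cinner (V x) y = cinner x (S y)" using adjoint_exists[OF V] by blast
  define p where "p = V (S y)"
  have orth: "cinner (V x) (y - p) = 0" for x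
    by (simp only: p_def cinner_diff_right iso) (simp add: S)
  have eq: "orth_proj (range V) y = p"
    unfolding orth_proj_def
  proof (rule the_equality)
    show "p \<in> range V \<and> (\<forall>m\<in>range V. cinner (y - p) m = 0)"
      using orth by (auto simp: p_def) (metis cinner_commute complex_cnj_zero)
  next
    fix q assume q: "q \<in> range V \<and> (\<forall>m\<in>range V. cinner (y - q) m = 0)"
    then obtain u where u: "q = V u" by auto
    have "u = S y"
    proof (rule cinner_ext)
      fix x
      have "cinner (V x) (y - q) = 0" using q by (metis cinner_commute complex_cnj_zero rangeI)
      then have "cinner (V x) y - cinner x u = 0" by (simp only: u cinner_diff_right iso)
      then show "cinner x u = cinner x (S y)" by (simp add: S)
    qed
    then show "q = p" by (simp add: u p_def)
  qed
  \<comment> \<open>\<open>y - p\<close> is orthogonal to \<open>p\<close>, which lies in the range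
    of \<open>V\<close>.\<close>
  have "inner p p = inner p y"
    using orth[of "S y"] by (simp add: inner_eq_Re_cinner p_def cinner_diff_right)
  then have "(norm p)\<^sup>2 \<le> norm p * norm y"
    by (metis norm_cauchy_schwarz power2_norm_eq_inner)
  then have "norm p \<le> norm y"
    by (cases "p = 0") (auto simp: power2_eq_square)
  then show ?thesis by (simp add: eq)
qed

section \<open>Resolvents of power bounded operators\<close>

lemma bounded_clinear_scaleC:
  assumes "bounded_clinear T"
  shows "bounded_clinear (\<lambda>x. a *\<^sub>C T x)"
proof -
  interpret T: bounded_linear T using assms by (simp add: bounded_clinear_def)
  obtain K where K: "\<And>x. norm (T x) \<le> norm x * K" using T.bounded by blast
  have sc: "\<And>b x. T (b *\<^sub>C x) = b *\<^sub>C T x" using assms by (simp add: bounded_clinear_def)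
  have "bounded_linear (\<lambda>x. a *\<^sub>C T x)"
  proof (rule bounded_linear_intro[where K = "cmod a * K"])
    show "norm (a *\<^sub>C T x) \<le> norm x * (cmod a * K)" for x
      using mult_left_mono[OF K[of x], of "cmod a"] by (simp add: norm_scaleC mult_ac)
  qed (simp_all add: T.add scaleC_add_right scaleR_eq_scaleC scaleC_scaleC sc mult.commute)
  then show ?thesis by (simp add: bounded_clinear_def sc scaleC_scaleC mult.commute)
qed

lemma bounded_clinear_ident: "bounded_clinear (\<lambda>x. x)"
  by (simp add: bounded_clinear_def bounded_linear_ident)

lemma bounded_clinear_compose:
  "bounded_clinear S \<Longrightarrow> bounded_clinear T \<Longrightarrow> bounded_clinear (\<lambda>x. S (T x))"
  by (simp add: bounded_clinear_def bounded_linear_compose)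

lemma bounded_clinear_id_minus:
  assumes "bounded_clinear T"
  shows "bounded_clinear (\<lambda>x. x - a *\<^sub>C T x)"
  using bounded_clinear_scaleC[OF assms, of a]
  by (simp add: bounded_clinear_def scaleC_diff_right bounded_linear_sub bounded_linear_ident)

lemma bounded_clinear_inv:
  assumes A: "bounded_clinear A" and "bij A" and "m > 0" and lower: "\<And>x. m * norm x \<le> norm (A x)"
  shows "bounded_clinear (inv A)"
proof -
  interpret A: bounded_linear A using A by (simp add: bounded_clinear_def)
  have sc: "\<And>b x. A (b *\<^sub>C x) = b *\<^sub>C A x" using A by (simp add: bounded_clinear_def)
  have AI: "A (inv A x) = x" for x using \<open>bij A\<close> by (simp add: bij_is_surj surj_f_inv_f)
  have I: "inv A x = y" if "A y = x" for x y
    using that \<open>bij A\<close> by (metis bij_is_inj inv_f_f)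
  have "bounded_linear (inv A)"
  proof (rule bounded_linear_intro[where K = "1 / m"])
    show "norm (inv A x) \<le> norm x * (1 / m)" for x
      using lower[of "inv A x"] \<open>m > 0\<close> by (simp add: AI field_simps)
  qed (auto intro!: I simp: A.add A.scaleR AI)
  moreover have "inv A (a *\<^sub>C x) = a *\<^sub>C inv A x" for a x by (rule I) (simp add: sc AI)
  ultimately show ?thesis by (simp add: bounded_clinear_def)
qed

text \<open>The hypothesis is on the powers, since \<open>B\<close> itself may have norm above 1
  when \<open>M > 1\<close>. The geometric bound makes the Neumann series converge, and summing it
  gives the quantitative estimate.\<close>

lemma neumann_series:
  fixes B :: "'a::banach \<Rightarrow> 'a"
  assumes "bounded_linear B" and q: "0 \<le> q" "q < 1"
    and bound: "\<And>n x. norm ((B ^^ n) x) \<le> M * q ^ n * norm x"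
  shows "bij (\<lambda>x. x - B x)"
    and "(1 - q) * norm x \<le> M * norm (x - B x)"
proof -
  interpret B: bounded_linear B by fact
  have pow: "bounded_linear (B ^^ n)" for n
    by (induction n) (auto simp: id_def o_def intro: bounded_linear_compose assms)
  have geo: "summable (\<lambda>n. M * q ^ n * norm y)" for y :: 'a
    using q by (intro summable_mult summable_mult2 summable_geometric) auto
  have summ: "summable (\<lambda>n. norm ((B ^^ n) y))" for y
    by (rule summable_comparison_test'[OF geo[of y], of 0]) (simp add: bound)
  \<comment> \<open>Telescoping recovers \<open>x\<close> from \<open>x - B x\<close>; this serves
    both injectivity and the norm estimate.\<close>
  have tele: "(\<lambda>n. (B ^^ n) (x - B x)) sums x" for x
  proof -
    have "(\<lambda>n. (B ^^ n) x) \<longlonglongrightarrow> 0"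
      by (rule summable_LIMSEQ_zero[OF summable_norm_cancel[OF summ]])
    from telescope_sums'[OF this]
    have "(\<lambda>n. (B ^^ n) x - (B ^^ Suc n) x) sums x" by simp
    moreover have "(B ^^ n) (x - B x) = (B ^^ n) x - (B ^^ Suc n) x" for n
      using linear_diff[OF bounded_linear.linear[OF pow], of n x "B x"] by (simp add: funpow_swap1)
    ultimately show ?thesis by simp
  qed
  show "bij (\<lambda>x. x - B x)"
  proof (rule bijI)
    show "inj (\<lambda>x. x - B x)" by (rule injI) (metis tele sums_unique2)
    show "surj (\<lambda>x. x - B x)"
    proof (rule surjI)
      fix y
      \<comment> \<open>The preimage of \<open>y\<close> is its Neumann series: applying
        \<open>B\<close> just drops the first term.\<close>
      have s: "summable (\<lambda>n. (B ^^ n) y)" by (rule summable_norm_cancel[OF summ])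
      have "B (\<Sum>n. (B ^^ n) y) = (\<Sum>n. (B ^^ Suc n) y)"
        using B.suminf[OF s] by simp
      then show "(\<Sum>n. (B ^^ n) y) - B (\<Sum>n. (B ^^ n) y) = y"
        using suminf_split_head[OF s] by simp
    qed
  qed
  define y where "y = x - B x"
  have "norm x = norm (\<Sum>n. (B ^^ n) y)" using tele[of x] by (simp add: y_def sums_iff)
  also have "\<dots> \<le> (\<Sum>n. norm ((B ^^ n) y))" by (rule summable_norm[OF summ])
  also have "\<dots> \<le> (\<Sum>n. M * q ^ n * norm y)" by (rule suminf_le[OF bound summ geo])
  also have "\<dots> = M * norm y * (\<Sum>n. q ^ n)"
    using q by (subst suminf_mult[symmetric]) (auto simp: ac_simps summable_geometric)
  also have "\<dots> = M * norm y / (1 - q)" using q by (simp add: suminf_geometric)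
  finally show "(1 - q) * norm x \<le> M * norm (x - B x)"
    using q by (simp add: y_def field_simps)
qed

definition power_bounded :: "real \<Rightarrow> ('a::real_normed_vector \<Rightarrow> 'a) \<Rightarrow> bool"
  where "power_bounded M T \<longleftrightarrow> (\<forall>n x. norm ((T ^^ n) x) \<le> M * norm x)"

text \<open>Compressing a power of a unitary does not increase norms, which gives the bound
  \<open>\<rho>\<close> for \<open>n \<ge> 1\<close>; the power \<open>n = 0\<close> is the identity
  and accounts for the 1 in the maximum.\<close>

lemma rho_class_power_bounded:
  fixes T :: "'h::chilbert_space \<Rightarrow> 'h"
  assumes "\<rho> > 0" "T \<in> rho_class TYPE('k::chilbert_space) \<rho>"
  shows "power_bounded (max 1 \<rho>) T"
  unfolding power_bounded_def
proof (intro allI)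
  fix n x
  obtain V :: "'h \<Rightarrow> 'k" and U where V: "bounded_clinear V"
    and iso: "\<And>x y. cinner (V x) (V y) = cinner x y" and U: "unitary_op U"
    and dil: "\<And>n x. n \<ge> 1 \<Longrightarrow> V ((T ^^ n) x) = \<rho> *\<^sub>R orth_proj (range V) ((U ^^ n) (V x))"
    using assms(2) unfolding rho_class_def is_unitary_rho_dilation_def by blast
  have nV: "norm (V y) = norm y" for y
    by (simp add: norm_eq_sqrt_inner inner_eq_Re_cinner iso)
  have nU: "norm ((U ^^ n) y) = norm y" for y
    by (induction n) (simp_all add: norm_unitary_op[OF U])
  show "norm ((T ^^ n) x) \<le> max 1 \<rho> * norm x"
  proof (cases "n = 0")
    case True
    then show ?thesis by (simp add: mult_right_mono[of 1 "max 1 \<rho>" "norm x", simplified])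
  next
    case False
    then have "norm ((T ^^ n) x) = \<rho> * norm (orth_proj (range V) ((U ^^ n) (V x)))"
      using \<open>\<rho> > 0\<close> by (simp add: dil flip: nV)
    also have "\<dots> \<le> \<rho> * norm x"
      using norm_orth_proj_range_le[OF V iso, of "(U ^^ n) (V x)"] \<open>\<rho> > 0\<close> by (simp add: nU nV)
    also have "\<dots> \<le> max 1 \<rho> * norm x" by (intro mult_right_mono) auto
    finally show ?thesis .
  qed
qed

lemma power_bounded_resolvent:
  fixes T :: "'a::chilbert_space \<Rightarrow> 'a"
  assumes T: "bounded_clinear T" and pb: "power_bounded M T" and a: "cmod a < 1"
  shows "bij (\<lambda>x. x - a *\<^sub>C T x)"
    and "(1 - cmod a) * norm x \<le> M * norm (x - a *\<^sub>C T x)"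
proof -
  define B where "B = (\<lambda>x. a *\<^sub>C T x)"
  have sc: "\<And>b x. T (b *\<^sub>C x) = b *\<^sub>C T x" using T by (simp add: bounded_clinear_def)
  have bl: "bounded_linear B"
    using bounded_clinear_scaleC[OF T, of a] by (simp add: B_def bounded_clinear_def)
  have pow: "(T ^^ n) (b *\<^sub>C x) = b *\<^sub>C (T ^^ n) x" for n b x
    by (induction n) (auto simp: sc)
  have "(B ^^ n) x = a ^ n *\<^sub>C (T ^^ n) x" for n x
    by (induction n) (auto simp: B_def sc scaleC_scaleC scaleC_one mult.commute)
  then have "norm ((B ^^ n) x) \<le> M * cmod a ^ n * norm x" for n x
    using mult_left_mono[OF pb[unfolded power_bounded_def, rule_format, of n x], of "cmod a ^ n"]
    by (simp add: norm_scaleC norm_power mult_ac)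
  from neumann_series[OF bl norm_ge_zero a this]
  show "bij (\<lambda>x. x - a *\<^sub>C T x)" "(1 - cmod a) * norm x \<le> M * norm (x - a *\<^sub>C T x)"
    by (auto simp: B_def)
qed

section \<open>The spectrum on the unit circle\<close>

text \<open>On the unit circle \<open>T - l\<close> is \<open>- l\<close> times
  \<open>I - cnj l T\<close>, the radial limit of the operators inverted in the kernel. A bound on
  the inverse is expressed as a lower bound on the operator.\<close>

lemma not_in_op_spectrum_iff:
  fixes T :: "'a::chilbert_space \<Rightarrow> 'a"
  assumes T: "bounded_clinear T" and l: "cmod l = 1"
  shows "l \<notin> op_spectrum T \<longleftrightarrow>
    bij (\<lambda>x. x - cnj l *\<^sub>C T x) \<and> (\<exists>m>0. \<forall>x. m * norm x \<le> norm (x - cnj l *\<^sub>C T x))"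
    (is "_ \<longleftrightarrow> bij ?A \<and> _")
proof -
  have ll: "l * cnj l = 1" "cnj l * l = 1"
    using l by (simp_all add: complex_norm_square[symmetric] mult.commute)
  have A: "bounded_clinear ?A" by (rule bounded_clinear_id_minus[OF T])
  then have Asc: "?A (b *\<^sub>C x) = b *\<^sub>C ?A x" for b x by (simp add: bounded_clinear_def)
  have TA: "T x - l *\<^sub>C x = (- l) *\<^sub>C ?A x" for x
  proof -
    have "(- l) *\<^sub>C ?A x = - (l *\<^sub>C ?A x)"
      by (metis mult_minus1 scaleC_minus1 scaleC_scaleC)
    then show ?thesis by (simp add: scaleC_diff_right scaleC_scaleC ll scaleC_one)
  qed
  show ?thesis
  proof
    assume "l \<notin> op_spectrum T"
    then obtain S where S: "bounded_clinear S" "\<And>x. S (T x - l *\<^sub>C x) = x"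
        "\<And>x. T (S x) - l *\<^sub>C S x = x"
      unfolding op_spectrum_def by (auto simp: fun_eq_iff)
    have SA: "S ((- l) *\<^sub>C ?A x) = x" for x using S(2) by (simp add: TA)
    have AS: "(- l) *\<^sub>C ?A (S x) = x" for x using S(3) by (simp only: TA)
    have "bij ?A"
    proof (rule bijI)
      show "inj ?A" by (rule injI) (metis SA)
      show "surj ?A"
      proof (rule surjI)
        fix y
        show "?A (S ((- l) *\<^sub>C y)) = y"
          using arg_cong[OF AS[of "(- l) *\<^sub>C y"], of "\<lambda>v. (- cnj l) *\<^sub>C v"]
          by (simp only: scaleC_scaleC) (simp add: ll scaleC_one)
      qed
    qed
    moreover obtain K where K: "K > 0" "\<And>x. norm (S x) \<le> norm x * K"
      using S(1) bounded_linear.pos_bounded unfolding bounded_clinear_def by blast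
    have "1 / K * norm x \<le> norm (?A x)" for x
      using K(2)[of "(- l) *\<^sub>C ?A x"] K(1) by (simp only: SA) (simp add: norm_scaleC l field_simps)
    ultimately show "bij ?A \<and> (\<exists>m>0. \<forall>x. m * norm x \<le> norm (?A x))"
      using K(1) by (metis divide_pos_pos zero_less_one)
  next
    assume "bij ?A \<and> (\<exists>m>0. \<forall>x. m * norm x \<le> norm (?A x))"
    then obtain m where bij: "bij ?A" and m: "m > 0" "\<And>x. m * norm x \<le> norm (?A x)" by blast
    define R where "R = inv ?A"
    have R: "bounded_clinear R" unfolding R_def by (rule bounded_clinear_inv[OF A bij m])
    have RA: "R (?A x) = x" for x
      unfolding R_def by (rule inv_f_f[OF bij_is_inj[OF bij]])
    have AR: "?A (R x) = x" for x
      unfolding R_def by (rule surj_f_inv_f[OF bij_is_surj[OF bij]])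
    have Rsc: "R (b *\<^sub>C x) = b *\<^sub>C R x" for b x using R by (simp add: bounded_clinear_def)
    define S where "S = (\<lambda>x. R ((- cnj l) *\<^sub>C x))"
    have "bounded_clinear S"
      unfolding S_def
      by (intro bounded_clinear_compose[OF R] bounded_clinear_scaleC bounded_clinear_ident)
    moreover have "S (T x - l *\<^sub>C x) = x" for x
      unfolding TA S_def scaleC_scaleC by (simp add: ll scaleC_one RA)
    moreover have "T (S x) - l *\<^sub>C S x = x" for x
    proof -
      have "S x = (- cnj l) *\<^sub>C R x" by (simp only: S_def Rsc)
      then have "?A (S x) = (- cnj l) *\<^sub>C x" by (simp only: Asc AR)
      then have "T (S x) - l *\<^sub>C S x = (- l) *\<^sub>C ((- cnj l) *\<^sub>C x)" by (simp only: TA)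
      then show ?thesis unfolding scaleC_scaleC by (simp add: ll scaleC_one)
    qed
    ultimately show "l \<notin> op_spectrum T"
      unfolding op_spectrum_def by (auto simp: fun_eq_iff intro!: exI[of _ S])
  qed
qed

text \<open>With \<open>y = T x\<close> and \<open>0 \<le> r \<le> 1\<close>, the operator
  \<open>I - r a T\<close> appears as a convex combination of \<open>I\<close> and
  \<open>I - a T\<close>.\<close>

lemma radial_shift:
  "x - (complex_of_real r * a) *\<^sub>C y = (1 - r) *\<^sub>R x + r *\<^sub>R (x - a *\<^sub>C (y::'a::chilbert_space))"
proof -
  have "(complex_of_real r * a) *\<^sub>C y = r *\<^sub>R (a *\<^sub>C y)"
    by (simp add: scaleR_eq_scaleC scaleC_scaleC)
  then show ?thesis by (simp add: algebra_simps)
qed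

lemma radial_lower_bound:
  fixes T :: "'a::chilbert_space \<Rightarrow> 'a"
  assumes T: "bounded_linear T" and l: "cmod l = 1"
    and m: "m > 0" "\<And>x. m * norm x \<le> norm (x - cnj l *\<^sub>C T x)"
  obtains d where "0 < d" "d < 1"
    "\<And>r x. \<bar>1 - r\<bar> \<le> d \<Longrightarrow> m / 2 * norm x \<le> norm (x - (complex_of_real r * cnj l) *\<^sub>C T x)"
proof -
  obtain K where K: "K > 0" "\<And>x. norm (T x) \<le> norm x * K"
    using T bounded_linear.pos_bounded by blast
  \<comment> \<open>\<open>m / (2 * K)\<close> keeps the perturbation \<open>(1 - r) cnj l T\<close>
    below half of the lower bound \<open>m\<close>; \<open>1/2\<close> ensures
    \<open>d < 1\<close>.\<close>
  define d where "d = min (1/2) (m / (2 * K))"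
  have d: "0 < d" "d < 1" "d * K \<le> m / 2" using K m(1) by (auto simp: d_def min_def field_simps)
  have "m / 2 * norm x \<le> norm (x - (complex_of_real r * cnj l) *\<^sub>C T x)" if r: "\<bar>1 - r\<bar> \<le> d" for r x
  proof -
    have "x - cnj l *\<^sub>C T x = (x - (complex_of_real r * cnj l) *\<^sub>C T x)
        - (complex_of_real (1 - r) * cnj l) *\<^sub>C T x"
      by (simp only: diff_diff_eq scaleC_add_left[symmetric] distrib_right[symmetric]
          of_real_add[symmetric]) simp
    then have "norm (x - cnj l *\<^sub>C T x) \<le> norm (x - (complex_of_real r * cnj l) *\<^sub>C T x)
        + norm ((complex_of_real (1 - r) * cnj l) *\<^sub>C T x)"
      by (metis norm_triangle_ineq4)
    moreover have "norm ((complex_of_real (1 - r) * cnj l) *\<^sub>C T x) \<le> m / 2 * norm x"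
    proof -
      have "norm ((complex_of_real (1 - r) * cnj l) *\<^sub>C T x) = \<bar>1 - r\<bar> * norm (T x)"
        unfolding norm_scaleC norm_mult norm_of_real using l by simp
      also have "\<dots> \<le> d * (norm x * K)" using r d(1) K by (intro mult_mono) auto
      also have "\<dots> = d * K * norm x" by simp
      also have "\<dots> \<le> m / 2 * norm x" using d(3) by (intro mult_right_mono) auto
      finally show ?thesis .
    qed
    ultimately show ?thesis using m(2)[of x] by simp
  qed
  then show ?thesis using that d by blast
qed

text \<open>
  Spectral points on the unit circle are approximate eigenvalues: a lower bound for
  \<open>I - \<lambda>\<^sup>* T\<close> would bound the resolvents at \<open>r \<lambda>\<close> and so give, for \<open>r\<close> close to 1, the
  factorisation of \<open>I - \<lambda>\<^sup>* T\<close> into invertible operators used in the proof.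
\<close>

lemma unit_spectrum_approximate_eigenvector:
  fixes T :: "'a::chilbert_space \<Rightarrow> 'a"
  assumes T: "bounded_clinear T" and pb: "power_bounded M T"
    and l: "cmod l = 1" "l \<in> op_spectrum T" and "e > 0"
  obtains x where "norm x = 1" "norm (x - cnj l *\<^sub>C T x) < e"
proof -
  have blT: "bounded_linear T" and sc: "\<And>b x. T (b *\<^sub>C x) = b *\<^sub>C T x"
    using T by (auto simp: bounded_clinear_def)
  have "\<not> (\<forall>x. e * norm x \<le> norm (x - cnj l *\<^sub>C T x))"
  proof
    assume lower: "\<forall>x. e * norm x \<le> norm (x - cnj l *\<^sub>C T x)"
    obtain d where d: "0 < d" "d < 1"
      "\<And>r x. \<bar>1 - r\<bar> \<le> d \<Longrightarrow> e / 2 * norm x \<le> norm (x - (complex_of_real r * cnj l) *\<^sub>C T x)"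
      using radial_lower_bound[OF blT l(1) \<open>e > 0\<close>] lower by metis
    obtain K where K: "K > 0" "\<And>x. norm (T x) \<le> norm x * K"
      using blT bounded_linear.pos_bounded by blast
    \<comment> \<open>\<open>s \<le> d\<close> preserves the lower bound \<open>e / 2\<close> for
      \<open>A\<close> below, so its inverse has norm at most \<open>2 / e\<close>; then
      \<open>s * K \<le> e / 4\<close> brings the norm of \<open>B\<close> down to
      \<open>1/2\<close>.\<close>
    define s where "s = min d (e / (4 * K))"
    have s: "0 < s" "s \<le> d" "s * K \<le> e / 4" using d K \<open>e > 0\<close> by (auto simp: s_def min_def field_simps)
    define a where "a = complex_of_real (1 - s) * cnj l"
    define A where "A = (\<lambda>x. x - a *\<^sub>C T x)"
    have "cmod a = \<bar>1 - s\<bar>" unfolding a_def norm_mult norm_of_real using l by simp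
    then have a: "cmod a < 1" using s d by simp
    have bij: "bij A" unfolding A_def by (rule power_bounded_resolvent(1)[OF T pb a])
    have low: "e / 2 * norm x \<le> norm (A x)" for x
      unfolding A_def a_def using s by (intro d(3)) simp
    have A: "bounded_clinear A" unfolding A_def by (rule bounded_clinear_id_minus[OF T])
    define R where "R = inv A"
    have R: "bounded_clinear R"
      unfolding R_def by (rule bounded_clinear_inv[OF A bij _ low]) (use \<open>e > 0\<close> in simp)
    have AR: "A (R x) = x" for x
      unfolding R_def by (rule surj_f_inv_f[OF bij_is_surj[OF bij]])
    have RA: "R (A x) = x" for x
      unfolding R_def by (rule inv_f_f[OF bij_is_inj[OF bij]])
    \<comment> \<open>Chosen so that \<open>I - cnj l T = (I - B) A\<close>: the missing part
      \<open>s cnj l T\<close> of \<open>I - cnj l T\<close> is \<open>B A\<close>.\<close>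
    define B where "B = (\<lambda>x. (complex_of_real s * cnj l) *\<^sub>C T (R x))"
    have blB: "bounded_linear B"
      using bounded_clinear_scaleC[OF bounded_clinear_compose[OF T R]]
      by (simp add: B_def bounded_clinear_def)
    have nB: "norm (B x) \<le> 1/2 * norm x" for x
    proof -
      have "norm (B x) = s * norm (T (R x))"
        unfolding B_def norm_scaleC norm_mult norm_of_real using l s by simp
      also have "\<dots> \<le> s * (norm (R x) * K)" using s K by (intro mult_left_mono) auto
      also have "\<dots> = s * K * norm (R x)" by simp
      also have "\<dots> \<le> e / 4 * norm (R x)" using s by (intro mult_right_mono) auto
      also have "\<dots> \<le> 1/2 * norm x" using low[of "R x"] by (simp add: AR)
      finally show ?thesis .
    qed
    have "norm ((B ^^ n) x) \<le> 1 * (1/2) ^ n * norm x" for n x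
    proof (induction n)
      case (Suc n)
      then show ?case using nB[of "(B ^^ n) x"] by simp
    qed simp
    then have bijB: "bij (\<lambda>x. x - B x)" by (intro neumann_series(1)[OF blB, of "1/2" 1]) auto
    have BA: "B (A x) = (complex_of_real s * cnj l) *\<^sub>C T x" for x by (simp add: B_def RA)
    have "A x - B (A x) = x - cnj l *\<^sub>C T x" for x
      by (simp only: BA, simp only: A_def a_def diff_diff_eq scaleC_add_left[symmetric]
          distrib_right[symmetric] of_real_add[symmetric]) simp
    then have fact: "(\<lambda>x. x - cnj l *\<^sub>C T x) = (\<lambda>x. x - B x) \<circ> A" by (simp add: fun_eq_iff)
    have "bij (\<lambda>x. x - cnj l *\<^sub>C T x)" unfolding fact by (rule bij_comp[OF bij bijB])
    then have "l \<notin> op_spectrum T"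
      using not_in_op_spectrum_iff[OF T l(1)] lower \<open>e > 0\<close> by blast
    then show False using l(2) by blast
  qed
  then obtain x where x: "norm (x - cnj l *\<^sub>C T x) < e * norm x" by (auto simp: not_le)
  then have "x \<noteq> 0" by auto
  define y where "y = complex_of_real (1 / norm x) *\<^sub>C x"
  have "y - cnj l *\<^sub>C T y = complex_of_real (1 / norm x) *\<^sub>C (x - cnj l *\<^sub>C T x)"
    by (simp add: y_def sc scaleC_diff_right scaleC_scaleC mult.commute)
  then have "norm (y - cnj l *\<^sub>C T y) = norm (x - cnj l *\<^sub>C T x) / norm x"
    by (simp add: norm_scaleC norm_divide)
  then have "norm (y - cnj l *\<^sub>C T y) < e" using x \<open>x \<noteq> 0\<close> by (simp add: divide_less_eq)
  moreover have "norm y = 1" using \<open>x \<noteq> 0\<close> by (simp add: y_def norm_scaleC norm_divide)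
  ultimately show ?thesis using that by blast
qed

section \<open>The kernel\<close>

text \<open>The two resolvents in the kernel are adjoint to each other, so their quadratic forms are
  conjugate and add up to twice a real part.\<close>

lemma cinner_rho_kernel:
  fixes T :: "'a::chilbert_space \<Rightarrow> 'a"
  assumes T: "bounded_clinear T" and pb: "power_bounded M T" and "M > 0" and z: "cmod z < 1"
  shows "cinner (rho_kernel \<rho> z T x) x = complex_of_real
    (2 * inner (inv (\<lambda>y. y - cnj z *\<^sub>C T y) x) x + (\<rho> - 2) * (norm x)\<^sup>2)"
proof -
  define A where "A = (\<lambda>y. y - cnj z *\<^sub>C T y)"
  define A' where "A' = (\<lambda>y. y - z *\<^sub>C cadjoint T y)"
  define R where "R = inv A"
  have z': "cmod (cnj z) < 1" using z by simp
  have bij: "bij A" unfolding A_def by (rule power_bounded_resolvent(1)[OF T pb z'])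
  have low: "(1 - cmod z) / M * norm x \<le> norm (A x)" for x
    using power_bounded_resolvent(2)[OF T pb z', of x] \<open>M > 0\<close> by (simp add: A_def field_simps)
  have A: "bounded_clinear A" unfolding A_def by (rule bounded_clinear_id_minus[OF T])
  have R: "bounded_clinear R"
    unfolding R_def by (rule bounded_clinear_inv[OF A bij _ low]) (use z \<open>M > 0\<close> in simp)
  have AR: "A (R x) = x" for x
    unfolding R_def by (rule surj_f_inv_f[OF bij_is_surj[OF bij]])
  have RA: "R (A x) = x" for x
    unfolding R_def by (rule inv_f_f[OF bij_is_inj[OF bij]])
  have AA': "cinner (A x) y = cinner x (A' y)" for x y
    by (simp add: A_def A'_def cinner_diff_left cinner_diff_right cinner_scaleC_left
        cinner_scaleC_right cinner_cadjoint[OF T])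
  \<comment> \<open>Taking adjoints in \<open>R A = I\<close> and \<open>A R = I\<close> shows that
    \<open>cadjoint R\<close> is a two-sided inverse of \<open>A'\<close>.\<close>
  have 1: "A' (cadjoint R y) = y" for y
    by (rule cinner_ext) (metis AA' RA cinner_cadjoint[OF R])
  have 2: "cadjoint R (A' y) = y" for y
    by (rule cinner_ext) (metis AA' AR cinner_cadjoint[OF R])
  have "inv A' = cadjoint R" by (rule inv_unique_comp) (auto simp: 1 2 fun_eq_iff)
  then have "rho_kernel \<rho> z T x = R x + cadjoint R x + (\<rho> - 2) *\<^sub>R x"
    by (simp add: rho_kernel_def R_def A_def A'_def)
  then have "cinner (rho_kernel \<rho> z T x) x =
      cinner (R x) x + cnj (cinner (R x) x) + complex_of_real ((\<rho> - 2) * (norm x)\<^sup>2)"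
    by (metis (no_types) cinner_add_left cinner_cadjoint[OF R] cinner_commute cinner_scaleC_left
        cinner_self of_real_mult scaleR_eq_scaleC)
  also have "\<dots> = complex_of_real (2 * inner (R x) x + (\<rho> - 2) * (norm x)\<^sup>2)"
    by (simp add: complex_add_cnj inner_eq_Re_cinner)
  finally show ?thesis by (simp add: R_def A_def)
qed

text \<open>Off the spectrum the lower bound \<open>m\<close> persists as \<open>m / 2\<close> along
  the radius near \<open>l\<close>, so the resolvents there have norm at most
  \<open>2 / m\<close>.\<close>

lemma resolvent_form_upper_bound:
  fixes T :: "'a::chilbert_space \<Rightarrow> 'a"
  assumes T: "bounded_clinear T" and l: "cmod l = 1" "l \<notin> op_spectrum T"
  assumes pb: "power_bounded M T"
  obtains d C where "0 < d" "d < 1"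
    "\<And>r x. 1 - d \<le> r \<Longrightarrow> r < 1 \<Longrightarrow> norm x = 1 \<Longrightarrow>
      inner (inv (\<lambda>y. y - (complex_of_real r * cnj l) *\<^sub>C T y) x) x \<le> C"
proof -
  obtain m where m: "m > 0" "\<And>x. m * norm x \<le> norm (x - cnj l *\<^sub>C T x)"
    using not_in_op_spectrum_iff[OF T l(1)] l(2) by blast
  obtain d where d: "0 < d" "d < 1"
    "\<And>r x. \<bar>1 - r\<bar> \<le> d \<Longrightarrow> m / 2 * norm x \<le> norm (x - (complex_of_real r * cnj l) *\<^sub>C T x)"
    using radial_lower_bound[of T l m] T l(1) m unfolding bounded_clinear_def by metis
  have "inner (inv (\<lambda>y. y - (complex_of_real r * cnj l) *\<^sub>C T y) x) x \<le> 2 / m"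
    if r: "1 - d \<le> r" "r < 1" and x: "norm x = 1" for r x
  proof -
    define A where "A = (\<lambda>y. y - (complex_of_real r * cnj l) *\<^sub>C T y)"
    have "cmod (complex_of_real r * cnj l) < 1"
      unfolding norm_mult norm_of_real using l r d by simp
    then have "bij A" unfolding A_def by (rule power_bounded_resolvent(1)[OF T pb])
    then have "A (inv A x) = x" by (metis bij_is_surj surj_f_inv_f)
    then have "m / 2 * norm (inv A x) \<le> 1" using d(3)[of r "inv A x"] r x by (simp add: A_def)
    then have "norm (inv A x) \<le> 2 / m" using m(1) by (simp add: field_simps)
    then show ?thesis using norm_cauchy_schwarz[of "inv A x" x] x by (simp add: A_def)
  qed
  then show ?thesis using that[of d "2 / m"] d by auto
qed

text \<open>If \<open>v = x - cnj l T x\<close> is small, then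
  \<open>x = (1 - r) R x + r R v\<close> with \<open>R v\<close> small, so
  \<open>(1 - r) * inner (R x) x\<close> is close to \<open>inner x x = 1\<close>.\<close>

lemma resolvent_form_lower_bound:
  fixes T :: "'a::chilbert_space \<Rightarrow> 'a"
  assumes T: "bounded_clinear T" and pb: "power_bounded M T" and "M > 0"
    and l: "cmod l = 1" "l \<in> op_spectrum T" and r: "0 < r" "r < 1"
  obtains x where "norm x = 1"
    "1 / (2 * (1 - r)) \<le> inner (inv (\<lambda>y. y - (complex_of_real r * cnj l) *\<^sub>C T y) x) x"
proof -
  define a where "a = complex_of_real r * cnj l"
  define A where "A = (\<lambda>y. y - a *\<^sub>C T y)"
  define R where "R = inv A"
  have ca: "cmod a = r" unfolding a_def norm_mult norm_of_real using l r by simp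
  then have a: "cmod a < 1" using r by simp
  have bij: "bij A" unfolding A_def by (rule power_bounded_resolvent(1)[OF T pb a])
  have low: "(1 - r) / M * norm x \<le> norm (A x)" for x
    using power_bounded_resolvent(2)[OF T pb a, of x] \<open>M > 0\<close> by (simp add: A_def ca field_simps)
  have A: "bounded_clinear A" unfolding A_def by (rule bounded_clinear_id_minus[OF T])
  have "bounded_clinear R"
    unfolding R_def by (rule bounded_clinear_inv[OF A bij _ low]) (use r \<open>M > 0\<close> in simp)
  then interpret R: bounded_linear R by (simp add: bounded_clinear_def)
  have AR: "A (R x) = x" for x
    unfolding R_def by (rule surj_f_inv_f[OF bij_is_surj[OF bij]])
  have RA: "R (A x) = x" for x
    unfolding R_def by (rule inv_f_f[OF bij_is_inj[OF bij]])
  \<comment> \<open>By \<open>low\<close>, \<open>R\<close> has norm at most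
    \<open>M / (1 - r)\<close>; this precision makes \<open>norm w\<close> at most
    \<open>1/2\<close>. The vector depends on \<open>r\<close>.\<close>
  obtain x where x: "norm x = 1" "norm (x - cnj l *\<^sub>C T x) < (1 - r) / (2 * M)"
    using unit_spectrum_approximate_eigenvector[OF T pb l, of "(1 - r) / (2 * M)"] r \<open>M > 0\<close> by auto
  define w where "w = R (x - cnj l *\<^sub>C T x)"
  have "(1 - r) / M * norm w \<le> (1 - r) / M * (1 / 2)" using low[of w] x(2) by (simp add: w_def AR)
  then have w: "norm w \<le> 1 / 2"
    by (rule mult_left_le_imp_le) (use r \<open>M > 0\<close> in simp)
  have "x = R ((1 - r) *\<^sub>R x + r *\<^sub>R (x - cnj l *\<^sub>C T x))"
    using RA[of x] by (simp add: A_def a_def radial_shift)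
  then have "x = (1 - r) *\<^sub>R R x + r *\<^sub>R w" by (simp add: R.add R.scaleR w_def)
  then have "inner x x = (1 - r) * inner (R x) x + r * inner w x"
    by (metis inner_add_left inner_scaleR_left)
  moreover have "r * inner w x \<le> 1 / 2"
  proof -
    have "inner w x \<le> 1 / 2" using norm_cauchy_schwarz[of w x] w x(1) by simp
    then have "r * inner w x \<le> r * (1 / 2)" using r by (intro mult_left_mono) auto
    also have "\<dots> \<le> 1 / 2" using r by simp
    finally show ?thesis .
  qed
  ultimately have "1 / 2 \<le> (1 - r) * inner (R x) x"
    using x(1) by (simp add: flip: power2_norm_eq_inner)
  then have "1 / (2 * (1 - r)) \<le> inner (R x) x" using r by (simp add: field_simps)
  then show ?thesis using that x(1) by (simp add: R_def A_def a_def)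
qed

section \<open>Harnack domination and the peripheral spectrum\<close>

lemma harnack_dominated_peripheral_spectrum:
  fixes T0 T1 :: "'h::chilbert_space \<Rightarrow> 'h"
  assumes T0: "bounded_clinear T0" and T1: "bounded_clinear T1"
    and pb0: "power_bounded M T0" and pb1: "power_bounded M T1" and M: "M > 0"
    and dom: "harnack_dominated \<rho> T1 T0"
  shows "peripheral_spectrum T1 \<subseteq> peripheral_spectrum T0"
proof (rule ccontr)
  assume "\<not> ?thesis"
  then obtain l where "l \<in> peripheral_spectrum T1" "l \<notin> peripheral_spectrum T0" by blast
  then have l: "cmod l = 1" "l \<in> op_spectrum T1" "l \<notin> op_spectrum T0"
    by (auto simp: peripheral_spectrum_def)
  obtain c where c: "\<And>z. z \<in> ball 0 1 \<Longrightarrow>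
      op_le (rho_kernel \<rho> z T1) (\<lambda>x. c\<^sup>2 *\<^sub>R rho_kernel \<rho> z T0 x)"
    using dom unfolding harnack_dominated_def by blast
  obtain d C where d: "0 < d" "d < 1" and up:
    "\<And>r x. 1 - d \<le> r \<Longrightarrow> r < 1 \<Longrightarrow> norm x = 1 \<Longrightarrow>
      inner (inv (\<lambda>y. y - (complex_of_real r * cnj l) *\<^sub>C T0 y) x) x \<le> C"
    using resolvent_form_upper_bound[OF T0 l(1,3) pb0] by metis
  \<comment> \<open>\<open>D\<close> is the bound that domination imposes on twice the resolvent
    form of \<open>T1\<close> at unit vectors. It depends on neither \<open>r\<close> nor
    \<open>x\<close>, so \<open>r\<close> can be fixed first and \<open>x\<close> chosen
    afterwards.\<close>
  define D where "D = c\<^sup>2 * (2 * C + (\<rho> - 2)) - (\<rho> - 2)"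
  \<comment> \<open>\<open>s \<le> d\<close> keeps \<open>r = 1 - s\<close> in the range of
    \<open>up\<close>; the other bound gives
    \<open>1 / s \<ge> \<bar>D\<bar> + 1 > D\<close>.\<close>
  define s where "s = min d (1 / (\<bar>D\<bar> + 1))"
  have s: "0 < s" "s \<le> d" "s \<le> 1 / (\<bar>D\<bar> + 1)" using d by (auto simp: s_def)
  define r where "r = 1 - s"
  have r: "0 < r" "r < 1" "1 - d \<le> r" using s d by (auto simp: r_def)
  have big: "D < 1 / (1 - r)"
  proof -
    have "s * (\<bar>D\<bar> + 1) \<le> 1" using s by (simp add: field_simps)
    then have "\<bar>D\<bar> + 1 \<le> 1 / s" using s(1) by (simp add: field_simps)
    then show ?thesis by (simp add: r_def)
  qed
  obtain x where x: "norm x = 1"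
    "1 / (2 * (1 - r)) \<le> inner (inv (\<lambda>y. y - (complex_of_real r * cnj l) *\<^sub>C T1 y) x) x"
    using resolvent_form_lower_bound[OF T1 pb1 M l(1,2) r(1,2)] by blast
  define z where "z = complex_of_real r * l"
  have z: "cmod z < 1" unfolding z_def norm_mult norm_of_real using l r by simp
  have cz: "cnj z = complex_of_real r * cnj l" by (simp add: z_def)
  define u where "u T = inner (inv (\<lambda>y. y - cnj z *\<^sub>C T y) x) x" for T :: "'h \<Rightarrow> 'h"
  have K: "cinner (rho_kernel \<rho> z T x) x = complex_of_real (2 * u T + (\<rho> - 2))"
    if "bounded_clinear T" "power_bounded M T" for T
    using cinner_rho_kernel[OF that M z, of \<rho> x] x(1) by (simp add: u_def)
  have "cinner (c\<^sup>2 *\<^sub>R rho_kernel \<rho> z T0 x - rho_kernel \<rho> z T1 x) x \<in> \<real>\<^sub>\<ge>\<^sub>0"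
    using c[of z] z by (simp add: op_le_def)
  \<comment> \<open>By \<open>K\<close> both kernel forms are real, so the operator inequality at
    \<open>x\<close> becomes an inequality of real numbers.\<close>
  then have "complex_of_real (c\<^sup>2 * (2 * u T0 + (\<rho> - 2)) - (2 * u T1 + (\<rho> - 2))) \<in> \<real>\<^sub>\<ge>\<^sub>0"
    by (simp only: cinner_diff_left scaleR_eq_scaleC cinner_scaleC_left K[OF T0 pb0] K[OF T1 pb1]
        of_real_mult[symmetric] of_real_diff[symmetric])
  then have "2 * u T1 + (\<rho> - 2) \<le> c\<^sup>2 * (2 * u T0 + (\<rho> - 2))"
    by (simp only: nonneg_Reals_of_real_iff diff_ge_0_iff_ge)
  also have "\<dots> \<le> c\<^sup>2 * (2 * C + (\<rho> - 2))"
    using up[OF r(3,2) x(1)] by (intro mult_left_mono) (auto simp: u_def cz)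
  finally have "2 * u T1 \<le> D" by (simp add: D_def)
  moreover have "1 / (1 - r) \<le> 2 * u T1" using x(2) r by (simp add: u_def cz field_simps)
  ultimately show False using big by linarith
qed

theorem corollary2p2:
  fixes \<rho> :: real and T0 T1 :: "'h::chilbert_space \<Rightarrow> 'h"
  assumes "\<rho> > 0"
    and "T0 \<in> rho_class TYPE('k0::chilbert_space) \<rho>"
    and "T1 \<in> rho_class TYPE('k1::chilbert_space) \<rho>"
    and "harnack_equivalent \<rho> T1 T0"
  shows "peripheral_spectrum T1 = peripheral_spectrum T0"
proof -
  have "bounded_clinear T0" "bounded_clinear T1"
    using assms(2,3) by (auto simp: rho_class_def)
  \<comment> \<open>The dilation spaces may differ, but both operators get the same power bound
    \<open>max 1 \<rho>\<close>. Each direction of domination then yields one inclusion.\<close>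
  moreover note rho_class_power_bounded[OF assms(1,2)] rho_class_power_bounded[OF assms(1,3)]
  moreover have "max 1 \<rho> > 0" by simp
  ultimately show ?thesis
    using assms(4) harnack_dominated_peripheral_spectrum
    unfolding harnack_equivalent_def by (metis subset_antisym)
qed

end
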